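(* Let $V$ be of diagonal type over $\mathbb{K}(q^{1/2})$ with symmetric braiding matrix $(q_{ij})$, $q_{ij}=q_{ji}$, whose entries are integral powers of $q^{1/2}$. Then the restriction of the bar involution $\overline{\phantom{x}}:T(V)\to T(V)$ to the defining ideal $\mathfrak{I}(V)$ induces a ($\mathbb{K}$-)linear automorphism of $\mathfrak{I}(V)$.
   Context: $\mathbb{K}$ is a field of characteristic $0$. $V$ has $\mathbb{K}(q^{1/2})$-basis $v_1,\dots,v_N$ and braiding $\sigma(v_i\otimes v_j)=q_{ij}\,v_j\otimes v_i$. $T(V)=\bigoplus_n V^{\otimes n}$ is the tensor algebra. The braid group $\mathfrak{B}_n$ acts on $V^{\otimes n}$ by $\sigma_i\mapsto\mathrm{id}^{\otimes(i-1)}\otimes\sigma\otimes\mathrm{id}^{\otimes(n-i-1)}$; $S_n=\sum_{w\in\mathfrak{S}_n}T_w$, with $T_w=\sigma_{i_1}\cdots\sigma_{i_r}$ for a reduced expression $w=s_{i_1}\cdots s_{i_r}$. The defining ideal of the Nichols algebra $\mathfrak{B}(V)=T(V)/\mathfrak{I}(V)$ is $\mathfrak{I}(V)=\bigoplus_{n\ge2}\ker(S_n)$. The bar involution is the $\mathbb{K}$-linear ring automorphism of $T(V)$ determined by $q^{1/2}\mapsto q^{-1/2}$ and $v_i\mapsto v_i$. *)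

theory Defs
  imports
    "HOL-Library.Poly_Mapping"
    "HOL-Computational_Algebra.Polynomial_Factorial"
    "HOL-Combinatorics.Permutations"
begin

section \<open>The field of coefficients\<close>

text \<open>
  The field \<open>\<bbbK>(q\<^sup>1\<^sup>/\<^sup>2)\<close> is \<^typ>\<open>'k poly fract\<close>, where the indeterminate
  of \<^typ>\<open>'k poly\<close> plays the role of \<open>q\<^sup>1\<^sup>/\<^sup>2\<close>.
\<close>

definition qhalf :: "'k::field poly fract"
  where "qhalf = to_fract [:0, 1:]"

definition const_fract :: "'k::field \<Rightarrow> 'k poly fract"
  where "const_fract c = to_fract [:c:]"

section \<open>The tensor algebra\<close>

instantiation list :: (type) monoid_add
begin

definition zero_list :: "'a list" where "zero_list = []"
definition plus_list :: "'a list \<Rightarrow> 'a list \<Rightarrow> 'a list" where "plus_list = (@)"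

instance by standard (simp_all add: zero_list_def plus_list_def)

end

text \<open>
  If \<open>V\<close> has a basis \<open>(v\<^sub>i)\<close> indexed by \<^typ>\<open>'i\<close>, then \<open>T(V)\<close> has as a basis the words
  \<open>v\<^sub>i\<^sub>1 \<otimes> \<dots> \<otimes> v\<^sub>i\<^sub>n\<close>, multiplied by concatenation. Elements are
  finitely supported functions on words; since \<^typ>\<open>'i list\<close> is a monoid under concatenation, the
  ring structure on \<open>\<Rightarrow>\<^sub>0\<close> provided by the library is the one of the tensor algebra, and
  \<open>V \<otimes> V\<close> sits inside it as the span of the words of length 2.
\<close>

type_synonym ('i, 'k) tensor_algebra = "'i list \<Rightarrow>\<^sub>0 'k poly fract"

definition word :: "'i list \<Rightarrow> ('i, 'k::field) tensor_algebra"
  where "word w = Poly_Mapping.single w 1"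

definition scalar :: "'k::field poly fract \<Rightarrow> ('i, 'k) tensor_algebra"
  where "scalar c = Poly_Mapping.single [] c"

definition scaleK :: "'k::field \<Rightarrow> ('i, 'k) tensor_algebra \<Rightarrow> ('i, 'k) tensor_algebra"
  where "scaleK c x = scalar (const_fract c) * x"

definition tensor_power :: "nat \<Rightarrow> ('i, 'k::field) tensor_algebra set"
  where "tensor_power n = {x. \<forall>w\<in>Poly_Mapping.keys x. length w = n}"

definition lin_ext ::
    "('i list \<Rightarrow> ('i, 'k::field) tensor_algebra) \<Rightarrow> ('i, 'k) tensor_algebra \<Rightarrow> ('i, 'k) tensor_algebra"
  where "lin_ext g x = (\<Sum>w\<in>Poly_Mapping.keys x. scalar (Poly_Mapping.lookup x w) * g w)"

section \<open>Braiding, quantum symmetrizers and the defining ideal\<close>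

text \<open>Only the values on \<open>V \<otimes> V\<close> are meaningful.\<close>

definition braiding ::
    "('i \<Rightarrow> 'i \<Rightarrow> 'k::field poly fract) \<Rightarrow> ('i, 'k) tensor_algebra \<Rightarrow> ('i, 'k) tensor_algebra"
  where "braiding Q = lin_ext (\<lambda>w. scalar (Q (w ! 0) (w ! 1)) * word [w ! 1, w ! 0])"

text \<open>
  The operator \<open>id\<^sup>\<otimes>\<^sup>(\<^sup>i\<^sup>-\<^sup>1\<^sup>) \<otimes> \<sigma> \<otimes> id\<^sup>\<otimes>\<^sup>(\<^sup>n\<^sup>-\<^sup>i\<^sup>-\<^sup>1\<^sup>)\<close> on \<open>V\<^sup>\<otimes>\<^sup>n\<close>, for \<open>1 \<le> i < n\<close>. The number \<open>n\<close> is
  recovered from the length of the words, so one definition serves all \<open>n\<close>.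
\<close>

definition braid_gen ::
    "('i \<Rightarrow> 'i \<Rightarrow> 'k::field poly fract) \<Rightarrow> nat \<Rightarrow> ('i, 'k) tensor_algebra \<Rightarrow> ('i, 'k) tensor_algebra"
  where "braid_gen Q i =
    lin_ext (\<lambda>w. word (take (i - 1) w) * braiding Q (word (take 2 (drop (i - 1) w))) * word (drop (i + 1) w))"

definition is_expression :: "nat \<Rightarrow> (nat \<Rightarrow> nat) \<Rightarrow> nat list \<Rightarrow> bool"
  where "is_expression n w js \<longleftrightarrow>
    set js \<subseteq> {1..<n} \<and> w = foldr (\<lambda>i f. transpose i (i + 1) \<circ> f) js id"

definition is_reduced_expression :: "nat \<Rightarrow> (nat \<Rightarrow> nat) \<Rightarrow> nat list \<Rightarrow> bool"
  where "is_reduced_expression n w js \<longleftrightarrow>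
    is_expression n w js \<and> (\<forall>ks. is_expression n w ks \<longrightarrow> length js \<le> length ks)"

text \<open>
  The operators \<open>braid_gen Q i\<close> satisfy the braid relations, so by Matsumoto's theorem
  the choice of the reduced expression is immaterial.
\<close>

definition braid_lift ::
    "('i \<Rightarrow> 'i \<Rightarrow> 'k::field poly fract) \<Rightarrow> nat \<Rightarrow> (nat \<Rightarrow> nat)
      \<Rightarrow> ('i, 'k) tensor_algebra \<Rightarrow> ('i, 'k) tensor_algebra"
  where "braid_lift Q n w =
    foldr (\<lambda>i f. braid_gen Q i \<circ> f) (SOME js. is_reduced_expression n w js) id"

definition quantum_symmetrizer ::
    "('i \<Rightarrow> 'i \<Rightarrow> 'k::field poly fract) \<Rightarrow> nat \<Rightarrow> ('i, 'k) tensor_algebra \<Rightarrow> ('i, 'k) tensor_algebra"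
  where "quantum_symmetrizer Q n x = (\<Sum>w | w permutes {1..n}. braid_lift Q n w x)"

definition ker_symmetrizer ::
    "('i \<Rightarrow> 'i \<Rightarrow> 'k::field poly fract) \<Rightarrow> nat \<Rightarrow> ('i, 'k) tensor_algebra set"
  where "ker_symmetrizer Q n = {x \<in> tensor_power n. quantum_symmetrizer Q n x = 0}"

definition nichols_ideal :: "('i \<Rightarrow> 'i \<Rightarrow> 'k::field poly fract) \<Rightarrow> ('i, 'k) tensor_algebra set"
  where "nichols_ideal Q =
    {\<Sum>n\<in>A. f n | A f. finite A \<and> A \<subseteq> {2..} \<and> (\<forall>n\<in>A. f n \<in> ker_symmetrizer Q n)}"

section \<open>The bar involution\<close>

definition is_bar_involution ::
    "(('i, 'k::field) tensor_algebra \<Rightarrow> ('i, 'k) tensor_algebra) \<Rightarrow> bool"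
  where "is_bar_involution \<phi> \<longleftrightarrow>
    bij \<phi> \<and> Vector_Spaces.linear scaleK scaleK \<phi> \<and>
    \<phi> 1 = 1 \<and> (\<forall>x y. \<phi> (x * y) = \<phi> x * \<phi> y) \<and>
    \<phi> (scalar qhalf) = scalar (inverse qhalf) \<and> (\<forall>i. \<phi> (word [i]) = word [i])"

text \<open>Existence and uniqueness are proved at the end, see \<open>ex1_bar_involution\<close>.\<close>

definition bar_involution :: "('i, 'k::field) tensor_algebra \<Rightarrow> ('i, 'k) tensor_algebra"
  where "bar_involution = (THE \<phi>. is_bar_involution \<phi>)"

definition linear_automorphism_on ::
    "('k::field \<Rightarrow> 'v::ab_group_add \<Rightarrow> 'v) \<Rightarrow> 'v set \<Rightarrow> ('v \<Rightarrow> 'v) \<Rightarrow> bool"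
  where "linear_automorphism_on scale S f \<longleftrightarrow>
    module.subspace scale S \<and> bij_betw f S S \<and>
    (\<forall>x\<in>S. \<forall>y\<in>S. f (x + y) = f x + f y) \<and> (\<forall>c. \<forall>x\<in>S. f (scale c x) = scale c (f x))"

section \<open>Existence and uniqueness of the bar involution\<close>

lemma const_fract_simps [simp]:
  "const_fract 0 = 0" "const_fract 1 = 1"
  "const_fract (a + b) = const_fract a + const_fract b"
  "const_fract (a * b) = const_fract a * const_fract b"
  by (simp_all add: const_fract_def flip: to_fract_add to_fract_mult one_pCons)

lemma qhalf_nonzero [simp]: "qhalf \<noteq> 0"
  by (simp add: qhalf_def)

lemma scalar_simps [simp]:
  "scalar 0 = 0" "scalar 1 = 1"
  "scalar (a + b) = scalar a + scalar b"
  "scalar (a * b) = scalar a * scalar b"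
  unfolding scalar_def
  by (simp_all add: single_add mult_single plus_list_def) (simp add: zero_list_def flip: single_one)

lemma word_simps: "word [] = 1" "word (u @ w) = word u * word w"
  by (simp_all add: word_def mult_single flip: plus_list_def zero_list_def)

lemma scalar_mult_word: "scalar c * word w = Poly_Mapping.single w c"
  by (simp add: scalar_def word_def mult_single plus_list_def)

lemma scalar_commute: "scalar c * x = x * scalar c"
  for x :: "('i, 'k::field) tensor_algebra"
proof (induction x rule: update_induct)
  case const
  then show ?case by simp
next
  case (update f a b)
  have "Poly_Mapping.update a b f = f + Poly_Mapping.single a b"
    using update(1) by (intro poly_mapping_eqI)
      (auto simp: lookup_update lookup_add lookup_single when_def in_keys_iff)
  then show ?case using update
    by (simp add: algebra_simps scalar_def mult_single plus_list_def)
qed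

lemma vector_space_scaleK: "vector_space scaleK"
  by standard (simp_all add: scaleK_def algebra_simps)

lemma tensor_induct [case_names zero add]:
  fixes x :: "('i, 'k::field) tensor_algebra"
  assumes "P 0" and "\<And>c w x. P x \<Longrightarrow> P (scalar c * word w + x)"
  shows "P x"
proof (induction x rule: update_induct)
  case const
  then show ?case by (rule assms(1))
next
  case (update f a b)
  have "Poly_Mapping.update a b f = scalar b * word a + f"
    unfolding scalar_mult_word
    using update(1) by (intro poly_mapping_eqI)
      (auto simp: lookup_update lookup_add lookup_single when_def in_keys_iff)
  then show ?case using update assms(2) by simp
qed

lemma fract_cases:
  fixes a :: "'k::field poly fract"
  obtains p r where "r \<noteq> 0" "a = to_fract p / to_fract r"
proof (cases a)
  case (Fract p r)
  then show ?thesis using that[of r p] by (simp add: to_fract_def)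
qed

lemma to_fract_pCons: "to_fract (pCons c p) = const_fract c + qhalf * to_fract p"
  by (simp add: const_fract_def qhalf_def flip: to_fract_add to_fract_mult)

lemma bar_involution_props:
  fixes \<phi> :: "('i, 'k::field) tensor_algebra \<Rightarrow> ('i, 'k) tensor_algebra"
  assumes "is_bar_involution \<phi>"
  shows bar_involution_props_add: "\<phi> (x + y) = \<phi> x + \<phi> y"
    and bar_involution_props_zero: "\<phi> 0 = 0"
    and bar_involution_props_mult: "\<phi> (x * y) = \<phi> x * \<phi> y"
    and bar_involution_props_one: "\<phi> 1 = 1"
    and bar_involution_props_qhalf: "\<phi> (scalar qhalf) = scalar (inverse qhalf)"
    and bar_involution_props_const: "\<phi> (scalar (const_fract c)) = scalar (const_fract c)"
proof -
  have hom: "module_hom scaleK scaleK \<phi>"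
    using assms unfolding is_bar_involution_def linear_iff_module_hom by blast
  show "\<phi> (x + y) = \<phi> x + \<phi> y" by (rule module_hom.add[OF hom])
  show "\<phi> 0 = 0" by (rule module_hom.zero[OF hom])
  show "\<phi> (x * y) = \<phi> x * \<phi> y" and one: "\<phi> 1 = 1"
    and "\<phi> (scalar qhalf) = scalar (inverse qhalf)"
    using assms unfolding is_bar_involution_def by blast+
  have "\<phi> (scaleK c 1) = scaleK c (\<phi> 1)" by (rule module_hom.scale[OF hom])
  then show "\<phi> (scalar (const_fract c)) = scalar (const_fract c)"
    by (simp add: scaleK_def one)
qed

lemma bar_involution_scalar_unique:
  fixes \<phi> \<psi> :: "('i, 'k::field) tensor_algebra \<Rightarrow> ('i, 'k) tensor_algebra"
  assumes "is_bar_involution \<phi>" "is_bar_involution \<psi>"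
  shows "\<phi> (scalar a) = \<psi> (scalar a)"
proof -
  note props = bar_involution_props[OF assms(1)] bar_involution_props[OF assms(2)]
  have poly: "\<phi> (scalar (to_fract p)) = \<psi> (scalar (to_fract p))" for p
    by (induction p) (simp_all add: to_fract_pCons props)
  obtain p r where r: "r \<noteq> 0" and a: "a = to_fract p / to_fract r"
    by (rule fract_cases)
  define R R' where "R = (scalar (to_fract r) :: ('i, 'k) tensor_algebra)"
    and "R' = (scalar (inverse (to_fract r)) :: ('i, 'k) tensor_algebra)"
  note mult1 = bar_involution_props_mult[OF assms(1)] and mult2 = bar_involution_props_mult[OF assms(2)]
  have aR: "scalar a * R = scalar (to_fract p)"
    unfolding R_def scalar_simps(4)[symmetric] using r by (simp add: a)
  have "\<phi> (scalar a) * \<phi> R = \<psi> (scalar a) * \<psi> R"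
    unfolding mult1[symmetric] mult2[symmetric] aR by (rule poly)
  then have *: "\<phi> (scalar a) * \<phi> R = \<psi> (scalar a) * \<phi> R"
    unfolding R_def poly .
  have "R * R' = 1"
    unfolding R_def R'_def scalar_simps(4)[symmetric] using r by simp
  then have inv: "\<phi> R * \<phi> R' = 1"
    unfolding mult1[symmetric] by (simp only: bar_involution_props_one[OF assms(1)])
  have "\<phi> (scalar a) * (\<phi> R * \<phi> R') = \<psi> (scalar a) * (\<phi> R * \<phi> R')"
    unfolding mult.assoc[symmetric] * ..
  then show ?thesis
    unfolding inv by simp
qed

lemma bar_involution_word:
  assumes "is_bar_involution \<phi>"
  shows "\<phi> (word w) = word w"
proof (induction w)
  case Nil
  then show ?case using bar_involution_props_one[OF assms] by (simp add: word_simps)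
next
  case (Cons i w)
  have "\<phi> (word [i]) = word [i]" using assms by (simp add: is_bar_involution_def)
  then have "\<phi> (word [i] * word w) = word [i] * word w"
    by (simp only: bar_involution_props_mult[OF assms] Cons)
  then show ?case by (simp flip: word_simps(2))
qed

lemma bar_involution_unique:
  assumes "is_bar_involution \<phi>" "is_bar_involution \<psi>"
  shows "\<phi> = \<psi>"
proof
  note props = bar_involution_props[OF assms(1)] bar_involution_props[OF assms(2)]
  fix x show "\<phi> x = \<psi> x"
    by (induction x rule: tensor_induct)
      (simp_all add: props bar_involution_word[OF assms(1)] bar_involution_word[OF assms(2)]
        bar_involution_scalar_unique[OF assms])
qed

definition bar_poly :: "'k::field poly \<Rightarrow> 'k poly fract"
  where "bar_poly p = poly (map_poly const_fract p) (inverse qhalf)"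

definition bar_field :: "'k::field poly fract \<Rightarrow> 'k poly fract"
  where "bar_field a = (SOME b. \<exists>p r. r \<noteq> 0 \<and> a = to_fract p / to_fract r \<and> b = bar_poly p / bar_poly r)"

lemma bar_poly_0 [simp]: "bar_poly 0 = 0"
  by (simp add: bar_poly_def)

lemma bar_poly_pCons: "bar_poly (pCons c p) = const_fract c + inverse qhalf * bar_poly p"
  by (simp add: bar_poly_def map_poly_pCons)

lemma bar_poly_const [simp]: "bar_poly [:c:] = const_fract c"
  by (simp add: bar_poly_pCons)

lemma bar_poly_1 [simp]: "bar_poly 1 = 1"
  using bar_poly_const[of 1] by (simp only: const_fract_simps flip: one_pCons)

lemma bar_poly_add: "bar_poly (p + r) = bar_poly p + bar_poly r"
  by (induction p r rule: poly_induct2) (simp_all add: bar_poly_pCons algebra_simps)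

lemma bar_poly_smult: "bar_poly (smult c p) = const_fract c * bar_poly p"
  by (induction p) (simp_all add: bar_poly_pCons algebra_simps)

lemma bar_poly_mult: "bar_poly (p * r) = bar_poly p * bar_poly r"
  by (induction p) (simp_all add: bar_poly_pCons bar_poly_add bar_poly_smult algebra_simps)

lemma to_fract_reflect: "to_fract (reflect_poly p) = qhalf ^ degree p * bar_poly p"
proof (induction p)
  case 0
  then show ?case by simp
next
  case (pCons c p)
  have m: "to_fract (monom c n) = const_fract c * qhalf ^ n" for n
    by (induction n) (simp_all add: monom_0 monom_Suc to_fract_pCons)
  show ?case
  proof (cases "p = 0")
    case True
    then show ?thesis by (simp flip: const_fract_def)
  next
    case False
    then show ?thesis
      by (simp add: reflect_poly_pCons' pCons.IH m bar_poly_pCons field_simps)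
  qed
qed

lemma bar_poly_eq_0_iff [simp]: "bar_poly p = 0 \<longleftrightarrow> p = 0"
proof
  assume "bar_poly p = 0"
  then have "to_fract (reflect_poly p) = 0" by (simp add: to_fract_reflect)
  then show "p = 0" by simp
qed simp

lemma bar_field_quot:
  assumes "r \<noteq> 0"
  shows "bar_field (to_fract p / to_fract r) = bar_poly p / bar_poly r"
  unfolding bar_field_def
proof (rule some1_equality)
  have "bar_poly p / bar_poly r = bar_poly p' / bar_poly r'"
    if "r' \<noteq> 0" and "to_fract p / to_fract r = to_fract p' / to_fract r'" for p' r'
  proof -
    have "to_fract (p * r') = to_fract (p' * r)"
      using that assms by (simp add: field_simps)
    then have "bar_poly p * bar_poly r' = bar_poly p' * bar_poly r"
      by (simp only: to_fract_eq_iff flip: bar_poly_mult)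
    then show ?thesis using that assms by (simp add: field_simps)
  qed
  then show "\<exists>!b. \<exists>p' r'. r' \<noteq> 0 \<and> to_fract p / to_fract r = to_fract p' / to_fract r' \<and>
      b = bar_poly p' / bar_poly r'"
    using assms by metis
  show "\<exists>p' r'. r' \<noteq> 0 \<and> to_fract p / to_fract r = to_fract p' / to_fract r' \<and>
      bar_poly p / bar_poly r = bar_poly p' / bar_poly r'"
    using assms by blast
qed

lemma bar_field_to_fract: "bar_field (to_fract p) = bar_poly p"
  using bar_field_quot[of 1 p] by simp

lemma bar_field_const [simp]: "bar_field (const_fract c) = const_fract c"
  by (simp add: const_fract_def[of c] bar_field_to_fract)

lemma bar_field_qhalf [simp]: "bar_field qhalf = inverse qhalf"
  by (subst qhalf_def) (simp add: bar_field_to_fract bar_poly_pCons)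

lemma bar_field_0 [simp]: "bar_field 0 = 0" and bar_field_1 [simp]: "bar_field 1 = 1"
  using bar_field_const[of 0] bar_field_const[of 1] by simp_all

lemma bar_field_mult: "bar_field (a * b) = bar_field a * bar_field b"
proof -
  obtain p r where r: "r \<noteq> 0" "a = to_fract p / to_fract r" by (rule fract_cases)
  obtain p' r' where r': "r' \<noteq> 0" "b = to_fract p' / to_fract r'" by (rule fract_cases)
  have "a * b = to_fract (p * p') / to_fract (r * r')" using r r' by simp
  then have "bar_field (a * b) = bar_poly (p * p') / bar_poly (r * r')"
    using r r' by (metis bar_field_quot mult_eq_0_iff)
  then show ?thesis using r r' by (simp add: bar_field_quot bar_poly_mult)
qed

lemma bar_field_add: "bar_field (a + b) = bar_field a + bar_field b"
proof -
  obtain p r where r: "r \<noteq> 0" "a = to_fract p / to_fract r" by (rule fract_cases)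
  obtain p' r' where r': "r' \<noteq> 0" "b = to_fract p' / to_fract r'" by (rule fract_cases)
  have "a + b = to_fract (p * r' + p' * r) / to_fract (r * r')"
    using r r' by (simp add: field_simps)
  then have "bar_field (a + b) = bar_poly (p * r' + p' * r) / bar_poly (r * r')"
    using r r' by (metis bar_field_quot mult_eq_0_iff)
  also have "\<dots> = bar_poly p / bar_poly r + bar_poly p' / bar_poly r'"
    using r r' by (simp add: bar_poly_mult bar_poly_add add_frac_eq)
  finally show ?thesis using r r' by (simp add: bar_field_quot)
qed

lemma bar_field_inverse: "bar_field (inverse a) = inverse (bar_field a)"
proof (cases "a = 0")
  case False
  then have "bar_field a * bar_field (inverse a) = 1" by (simp flip: bar_field_mult)
  then show ?thesis by (metis inverse_unique)
qed simp

lemma bar_field_bar_field [simp]: "bar_field (bar_field a) = a"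
proof -
  have poly: "bar_field (bar_poly p) = to_fract p" for p
    by (induction p) (simp_all add: bar_poly_pCons to_fract_pCons bar_field_add bar_field_mult bar_field_inverse)
  obtain p r where r: "r \<noteq> 0" "a = to_fract p / to_fract r" by (rule fract_cases)
  then show ?thesis
    by (simp add: bar_field_quot) (simp add: divide_inverse bar_field_mult bar_field_inverse poly)
qed

definition bar_coeffs :: "('i, 'k::field) tensor_algebra \<Rightarrow> ('i, 'k) tensor_algebra"
  where "bar_coeffs = Poly_Mapping.map bar_field"

lemma lookup_bar_coeffs: "Poly_Mapping.lookup (bar_coeffs x) w = bar_field (Poly_Mapping.lookup x w)"
  by (simp add: bar_coeffs_def Poly_Mapping.map.rep_eq when_def)

lemma bar_coeffs_add: "bar_coeffs (x + y) = bar_coeffs x + bar_coeffs y"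
  by (rule poly_mapping_eqI) (simp add: lookup_bar_coeffs lookup_add bar_field_add)

lemma bar_coeffs_single: "bar_coeffs (Poly_Mapping.single w c) = Poly_Mapping.single w (bar_field c)"
  by (rule poly_mapping_eqI) (simp add: lookup_bar_coeffs lookup_single when_def)

lemma bar_coeffs_0 [simp]: "bar_coeffs 0 = 0"
  by (rule poly_mapping_eqI) (simp add: lookup_bar_coeffs)

lemma bar_coeffs_scalar: "bar_coeffs (scalar c) = scalar (bar_field c)"
  by (simp add: scalar_def bar_coeffs_single)

lemma bar_coeffs_mult: "bar_coeffs (x * y) = bar_coeffs x * bar_coeffs y"
proof (induction x rule: tensor_induct)
  case (add c w x)
  have "bar_coeffs (Poly_Mapping.single w c * y) = Poly_Mapping.single w (bar_field c) * bar_coeffs y"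
  proof (induction y rule: tensor_induct)
    case (add d u y)
    then show ?case
      by (simp add: scalar_mult_word distrib_left bar_coeffs_add bar_coeffs_single mult_single bar_field_mult)
  qed simp
  then show ?case using add
    by (simp add: scalar_mult_word distrib_right bar_coeffs_add bar_coeffs_single)
qed simp

lemma is_bar_involution_bar_coeffs:
  "is_bar_involution (bar_coeffs :: ('i, 'k::field) tensor_algebra \<Rightarrow> _)"
proof -
  let ?bar = "bar_coeffs :: ('i, 'k) tensor_algebra \<Rightarrow> _"
  have "bij ?bar"
    by (rule o_bij[of bar_coeffs]) (auto intro!: poly_mapping_eqI simp: fun_eq_iff lookup_bar_coeffs)
  moreover have "Vector_Spaces.linear scaleK scaleK ?bar"
    using vector_space_scaleK
    by (auto simp: linear_iff_module_hom module_hom_iff module_iff_vector_space bar_coeffs_add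
        scaleK_def bar_coeffs_mult bar_coeffs_scalar)
  moreover have "?bar 1 = 1"
    using bar_coeffs_scalar[of 1] by simp
  moreover have "?bar (word [i]) = word [i]" for i
    by (simp add: word_def bar_coeffs_single)
  ultimately show ?thesis
    by (simp add: is_bar_involution_def bar_coeffs_mult bar_coeffs_scalar)
qed

theorem ex1_bar_involution: "\<exists>!\<phi>. is_bar_involution \<phi>"
  using is_bar_involution_bar_coeffs bar_involution_unique by blast

corollary bar_involution_eq_bar_coeffs: "bar_involution = bar_coeffs"
  unfolding bar_involution_def
  by (rule the1_equality[OF ex1_bar_involution], rule is_bar_involution_bar_coeffs)

end

theory Submission
  imports Defs
begin

text \<open>
  The bar involution inverts every \<open>q\<^sub>i\<^sub>j\<close>. As the braiding matrix is symmetric,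
  conjugation by the bar involution therefore turns the braiding \<open>\<sigma>\<close> into \<open>\<sigma>\<inverse>\<close>, the operator
  \<open>T\<^sub>w\<close> into the inverse of \<open>T\<^sub>u\<close> with \<open>u = w\<inverse>\<close>, and the quantum symmetrizer \<open>S\<^sub>n\<close> into the sum of
  the inverses of all \<open>T\<^sub>w\<close>. For the longest permutation \<open>w\<^sub>0\<close> the lengths in
  \<open>w\<^sub>0 = (w\<^sub>0 w\<inverse>) w\<close> add up, so the inverse of \<open>T\<^sub>w\<close> composed with \<open>T\<close> of \<open>w\<^sub>0\<close> is again a
  summand of \<open>S\<^sub>n\<close>. Hence \<open>S\<^sub>n\<close> and its conjugate differ by the operator of \<open>w\<^sub>0\<close>: the value of
  \<open>S\<^sub>n\<close> at the bar of \<open>x\<close> is the operator of \<open>w\<^sub>0\<close> applied to the bar of \<open>S\<^sub>n x\<close>. If \<open>S\<^sub>n x\<close>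
  vanishes, so does the former, and the bar involution maps \<open>ker S\<^sub>n\<close> into itself. Being its own
  inverse, it is bijective there.

  For a braiding of diagonal type this becomes a computation, because \<open>T\<^sub>w\<close> is explicit: it moves the letters of a word \<open>u\<close> by \<open>w\<close> and multiplies by the
  product of the entries \<open>Q u\<^sub>a u\<^sub>b\<close> over the inversions \<open>(a, b)\<close> of \<open>w\<close>
  (\<open>braid_lift_word\<close>). The inversions of \<open>w\<^sub>0 w\<close> are the pairs \<open>a < b\<close> that are not
  inversions of \<open>w\<close>, so the coefficients of \<open>w\<close> and \<open>w\<^sub>0 w\<close> multiply to the product over all
  pairs (\<open>braid_coeff_longest_comp\<close>), and by symmetry of \<open>Q\<close> that product depends only on the
  multiset of letters (\<open>braid_coeff_longest_permute_word\<close>). These two facts yield the identity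
  \<open>quantum_symmetrizer_bar_coeffs\<close> above.
\<close>

section \<open>Inversions and reduced expressions\<close>

definition inversions :: "nat \<Rightarrow> (nat \<Rightarrow> nat) \<Rightarrow> (nat \<times> nat) set"
  where "inversions n w = {(a, b). 1 \<le> a \<and> a < b \<and> b \<le> n \<and> w b < w a}"

lemma finite_inversions [simp]: "finite (inversions n w)"
  by (rule finite_subset[of _ "{1..n} \<times> {1..n}"]) (auto simp: inversions_def)

lemma inversions_id [simp]: "inversions n id = {}"
  by (auto simp: inversions_def)

abbreviation adj :: "nat \<Rightarrow> nat \<Rightarrow> nat"
  where "adj i \<equiv> transpose i (Suc i)"

lemma permutes_adj: "1 \<le> i \<Longrightarrow> i < n \<Longrightarrow> adj i permutes {1..n}"
  by (rule permutes_swap_id) auto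

lemma adj_less_iff: "x \<noteq> y \<Longrightarrow> {x, y} \<noteq> {i, Suc i} \<Longrightarrow> adj i x < adj i y \<longleftrightarrow> x < y"
  by (auto simp: transpose_def)

text \<open>
  Only the pair of positions that \<open>f\<close> sends to \<open>{i, i + 1}\<close> changes its relative order when the
  values \<open>i\<close> and \<open>i + 1\<close> are exchanged.
\<close>

lemma inversions_adj_comp:
  assumes f: "f permutes {1..n}" and i: "1 \<le> i" "i < n" and less: "inv f i < inv f (Suc i)"
  shows "inversions n (adj i \<circ> f) = insert (inv f i, inv f (Suc i)) (inversions n f)"
    and "(inv f i, inv f (Suc i)) \<notin> inversions n f"
proof -
  have ff: "f (inv f x) = x" "inv f (f x) = x" for x
    using permutes_inverses[OF f] by auto
  have mem: "1 \<le> inv f i" "inv f (Suc i) \<le> n"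
    using permutes_in_image[OF permutes_inv[OF f], of i] permutes_in_image[OF permutes_inv[OF f], of "Suc i"] i
    by auto
  show "(inv f i, inv f (Suc i)) \<notin> inversions n f"
    by (simp add: inversions_def ff )
  have "(a, b) \<in> inversions n (adj i \<circ> f) \<longleftrightarrow>
      (a, b) \<in> insert (inv f i, inv f (Suc i)) (inversions n f)" for a b
  proof (cases "a < b \<and> {f a, f b} = {i, Suc i}")
    case True
    have "\<not> (f a = Suc i \<and> f b = i)"
      using True less ff(2)[of a] ff(2)[of b] by auto
    then have "f a = i" "f b = Suc i"
      using True by (auto simp: doubleton_eq_iff)
    then show ?thesis
      using mem True ff(2)[of a] ff(2)[of b] by (auto simp: inversions_def)
  next
    case False
    have ne: "(a, b) \<noteq> (inv f i, inv f (Suc i))"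
      using False less ff(1) by auto
    show ?thesis
    proof (cases "a < b")
      case True
      then have "f b \<noteq> f a" using ff(2) by (metis less_irrefl)
      moreover have "{f b, f a} \<noteq> {i, Suc i}" using True False by (auto simp: doubleton_eq_iff)
      ultimately show ?thesis
        using adj_less_iff[of "f b" "f a" i] ne by (auto simp: inversions_def)
    qed (use ne in \<open>auto simp: inversions_def\<close>)
  qed
  then show "inversions n (adj i \<circ> f) = insert (inv f i, inv f (Suc i)) (inversions n f)"
    by auto
qed

lemma inv_adj_comp:
  assumes "f permutes {1..n}"
  shows "inv (adj i \<circ> f) k = inv f (adj i k)"
proof -
  have "bij f" using assms by (rule permutes_bij)
  then show ?thesis
    by (subst o_inv_distrib) auto
qed

lemma card_inversions_adj_comp:
  assumes f: "f permutes {1..n}" and i: "1 \<le> i" "i < n"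
  shows "card (inversions n (adj i \<circ> f)) =
    (if inv f i < inv f (Suc i) then card (inversions n f) + 1 else card (inversions n f) - 1)"
    and "inv f (Suc i) < inv f i \<Longrightarrow> card (inversions n f) > 0"
proof -
  have "inv f i \<noteq> inv f (Suc i)"
    using permutes_inj[OF permutes_inv[OF f]] by (metis injD n_not_Suc_n)
  \<comment> \<open>The decreasing case is the increasing one for \<open>adj i \<circ> f\<close>, from which \<open>f\<close> is recovered.\<close>
  moreover have down: "card (inversions n f) = card (inversions n (adj i \<circ> f)) + 1"
    if "inv f (Suc i) < inv f i"
  proof -
    have g: "adj i \<circ> f permutes {1..n}"
      by (rule permutes_compose[OF f permutes_adj[OF i]])
    have "adj i \<circ> (adj i \<circ> f) = f" by (simp add: fun_eq_iff)
    with inversions_adj_comp[OF g i] that show ?thesis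
      by (simp add: inv_adj_comp[OF f])
  qed
  ultimately show "card (inversions n (adj i \<circ> f)) =
    (if inv f i < inv f (Suc i) then card (inversions n f) + 1 else card (inversions n f) - 1)"
    using inversions_adj_comp[OF f i] by auto
  show "inv f (Suc i) < inv f i \<Longrightarrow> card (inversions n f) > 0"
    using down by simp
qed

lemma is_expression_Nil: "is_expression n w [] \<longleftrightarrow> w = id"
  by (simp add: is_expression_def)

lemma is_expression_Cons:
  "is_expression n w (i # js) \<longleftrightarrow> 1 \<le> i \<and> i < n \<and> (\<exists>f. is_expression n f js \<and> w = adj i \<circ> f)"
  by (auto simp: is_expression_def)

lemma is_expression_permutes: "is_expression n w js \<Longrightarrow> w permutes {1..n}"
proof (induction js arbitrary: w)
  case Nil
  then show ?case by (metis is_expression_Nil permutes_id)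
next
  case (Cons i js)
  then show ?case
    by (auto simp: is_expression_Cons intro!: permutes_compose permutes_adj simp del: One_nat_def)
qed

lemma card_inversions_le_length: "is_expression n w js \<Longrightarrow> card (inversions n w) \<le> length js"
proof (induction js arbitrary: w)
  case (Cons i js)
  then obtain f where f: "1 \<le> i" "i < n" "is_expression n f js" "w = adj i \<circ> f"
    by (auto simp: is_expression_Cons)
  have "card (inversions n w) \<le> card (inversions n f) + 1"
    using card_inversions_adj_comp(1)[OF is_expression_permutes[OF f(3)] f(1,2)]
    by (auto simp: f(4))
  with Cons.IH[OF f(3)] show ?case by simp
qed (simp add: is_expression_Nil)

lemma permutes_increasing_eq_id:
  fixes f :: "nat \<Rightarrow> nat"
  assumes f: "f permutes {1..n}" and inc: "\<And>i. 1 \<le> i \<Longrightarrow> i < n \<Longrightarrow> f i < f (Suc i)"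
  shows "f = id"
proof -
  have ge: "k \<le> f k" if "1 \<le> k" "k \<le> n" for k
    using that
  proof (induction k rule: nat_induct_at_least)
    case base
    then show ?case using permutes_in_image[OF f, of 1] by auto
  next
    case (Suc k)
    then show ?case using inc[of k] by simp
  qed
  \<comment> \<open>A permutation preserves the sum of \<open>{1..n}\<close>, so no value can exceed its argument.\<close>
  have "\<forall>k\<in>{1..n}. k = f k"
  proof -
    have *: "(\<Sum>k\<in>{1..n}. f k) = (\<Sum>k\<in>{1..n}. k)"
      using sum.permute[OF f, of id] by simp
    show ?thesis
    proof (rule ccontr)
      assume "\<not> ?thesis"
      then obtain k where "k \<in> {1..n}" "k < f k" using ge by force
      then have "(\<Sum>k\<in>{1..n}. k) < (\<Sum>k\<in>{1..n}. f k)"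
        using ge by (intro sum_strict_mono_ex1) auto
      with * show False by simp
    qed
  qed
  then show ?thesis using f by (metis eq_id_iff permutes_not_in)
qed

text \<open>
  Bubble sort: unless \<open>w\<close> is the identity, some adjacent transposition removes an inversion.
\<close>

lemma ex_expression_length_card_inversions:
  "w permutes {1..n} \<Longrightarrow> \<exists>js. is_expression n w js \<and> length js = card (inversions n w)"
proof (induction "card (inversions n w)" arbitrary: w rule: less_induct)
  case less
  show ?case
  proof (cases "\<forall>i. 1 \<le> i \<longrightarrow> i < n \<longrightarrow> inv w i < inv w (Suc i)")
    case True
    then have "inv w = id"
      using permutes_increasing_eq_id[OF permutes_inv[OF less.prems]] by blast
    then have "w = id"
      using permutes_inv_inv[OF less.prems] by simp
    then show ?thesis by (intro exI[of _ "[]"]) (simp add: is_expression_Nil)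
  next
    case False
    then obtain i where i: "1 \<le> i" "i < n" and "\<not> inv w i < inv w (Suc i)" by blast
    moreover have "inv w i \<noteq> inv w (Suc i)"
      using permutes_inj[OF permutes_inv[OF less.prems]] by (metis injD n_not_Suc_n)
    ultimately have gt: "inv w (Suc i) < inv w i" by simp
    let ?g = "adj i \<circ> w"
    have card: "card (inversions n w) = card (inversions n ?g) + 1"
      using card_inversions_adj_comp[OF less.prems i] gt by simp
    have "?g permutes {1..n}"
      by (rule permutes_compose[OF less.prems permutes_adj[OF i]])
    then obtain js where "is_expression n ?g js" "length js = card (inversions n ?g)"
      using less.hyps[of ?g] card by auto
    moreover have "w = adj i \<circ> ?g" by (simp add: fun_eq_iff)
    ultimately have "is_expression n w (i # js) \<and> length (i # js) = card (inversions n w)"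
      using card i by (auto simp: is_expression_Cons)
    then show ?thesis by blast
  qed
qed

text \<open>
  Each factor of an expression creates at most one inversion, and bubble sort attains the bound, so
  the reduced expressions are those with as many factors as there are inversions. Thus
  the expression selected in \<^const>\<open>braid_lift\<close> has that length.
\<close>

lemma reduced_expression_choice:
  assumes "w permutes {1..n}"
  defines "js \<equiv> SOME js. is_reduced_expression n w js"
  shows "is_expression n w js" "length js = card (inversions n w)"
proof -
  obtain ks where ks: "is_expression n w ks" "length ks = card (inversions n w)"
    using ex_expression_length_card_inversions[OF assms(1)] by blast
  then have "is_reduced_expression n w ks"
    using card_inversions_le_length by (auto simp: is_reduced_expression_def)
  then have "is_reduced_expression n w js"
    unfolding js_def by (rule someI)
  then show "is_expression n w js" "length js = card (inversions n w)"
    using ks card_inversions_le_length by (auto simp: is_reduced_expression_def le_antisym)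
qed

section \<open>Linear maps of the tensor algebra\<close>

abbreviation scaleF :: "'k::field poly fract \<Rightarrow> ('i, 'k) tensor_algebra \<Rightarrow> ('i, 'k) tensor_algebra"
  where "scaleF c x \<equiv> scalar c * x"

lemma module_scaleF: "module scaleF"
  by standard (simp_all add: algebra_simps)

lemma lookup_scaleF: "Poly_Mapping.lookup (scaleF c x) w = c * Poly_Mapping.lookup x w"
proof (induction x rule: tensor_induct)
  case (add d u x)
  have "scaleF c (scalar d * word u + x) = Poly_Mapping.single u (c * d) + scaleF c x"
    by (simp add: distrib_left flip: mult.assoc scalar_simps(4) scalar_mult_word)
  then show ?case
    by (simp add: add scalar_mult_word lookup_add lookup_single when_def distrib_left)
qed simp

lemma lin_ext_superset:
  assumes "finite S" "Poly_Mapping.keys x \<subseteq> S"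
  shows "lin_ext g x = (\<Sum>w\<in>S. scalar (Poly_Mapping.lookup x w) * g w)"
  unfolding lin_ext_def
  by (rule sum.mono_neutral_left) (use assms in \<open>auto simp: in_keys_iff\<close>)

lemma module_hom_lin_ext: "module_hom scaleF scaleF (lin_ext g)"
proof -
  have "lin_ext g (x + y) = lin_ext g x + lin_ext g y" for x y
  proof -
    let ?S = "Poly_Mapping.keys x \<union> Poly_Mapping.keys y"
    have "Poly_Mapping.keys (x + y) \<subseteq> ?S" by (rule Poly_Mapping.keys_add)
    then show ?thesis
      by (simp add: lin_ext_superset[of ?S] lookup_add distrib_right sum.distrib)
  qed
  moreover have "lin_ext g (scaleF c x) = scaleF c (lin_ext g x)" for c x
  proof -
    have "Poly_Mapping.keys (scaleF c x) \<subseteq> Poly_Mapping.keys x"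
      by (auto simp: in_keys_iff lookup_scaleF)
    then show ?thesis
      by (simp add: lin_ext_superset[of "Poly_Mapping.keys x"] lookup_scaleF sum_distrib_left mult.assoc)
  qed
  ultimately show ?thesis
    by (simp add: module_hom_iff module_scaleF)
qed

lemma lin_ext_word: "lin_ext g (word u) = g u"
  by (simp add: lin_ext_def word_def)

lemma additive_eq_on_words:
  fixes F G :: "('i, 'k::field) tensor_algebra \<Rightarrow> 'b::ab_group_add"
  assumes "additive F" "additive G"
    and "\<And>c u. u \<in> Poly_Mapping.keys x \<Longrightarrow> F (scalar c * word u) = G (scalar c * word u)"
  shows "F x = G x"
proof -
  let ?term = "\<lambda>u. scalar (Poly_Mapping.lookup x u) * word u"
  have x: "x = (\<Sum>u\<in>Poly_Mapping.keys x. ?term u)"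
    by (rule poly_mapping_eqI)
      (auto simp: scalar_mult_word lookup_sum lookup_single when_def in_keys_iff sum.delta)
  have "F (\<Sum>u\<in>Poly_Mapping.keys x. ?term u) = G (\<Sum>u\<in>Poly_Mapping.keys x. ?term u)"
    unfolding additive.sum[OF assms(1)] additive.sum[OF assms(2)] by (rule sum.cong) (simp_all add: assms(3))
  then show ?thesis by (simp only: x[symmetric])
qed

section \<open>The action of a braid lift on words\<close>

text \<open>
  The letter at place \<open>a\<close> moves to place \<open>w a\<close>. Permutations act on \<open>{1..n}\<close>, whereas list
  positions start from 0; hence the shifts by one, here and below. With the inverse, this is a left
  action.
\<close>

definition permute_word :: "(nat \<Rightarrow> nat) \<Rightarrow> 'i list \<Rightarrow> 'i list"
  where "permute_word w u = map (\<lambda>k. u ! (inv w (Suc k) - 1)) [0..<length u]"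

lemma length_permute_word [simp]: "length (permute_word w u) = length u"
  by (simp add: permute_word_def)

lemma nth_permute_word:
  "k < length u \<Longrightarrow> permute_word w u ! k = u ! (inv w (Suc k) - 1)"
  by (simp add: permute_word_def)

lemma permute_word_comp:
  assumes "w permutes {1..length u}" "v permutes {1..length u}"
  shows "permute_word (v \<circ> w) u = permute_word v (permute_word w u)"
proof (rule nth_equalityI)
  fix k assume "k < length (permute_word (v \<circ> w) u)"
  then have k: "k < length u" by simp
  have "inv v (Suc k) \<in> {1..length u}"
    using k permutes_in_image[OF permutes_inv[OF assms(2)]] by simp
  moreover have "inv (v \<circ> w) (Suc k) = inv w (inv v (Suc k))"
    by (simp add: o_inv_distrib permutes_bij[OF assms(1)] permutes_bij[OF assms(2)])
  ultimately show "permute_word (v \<circ> w) u ! k = permute_word v (permute_word w u) ! k"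
    using k by (auto simp: nth_permute_word)
qed simp

definition braid_coeff :: "('i \<Rightarrow> 'i \<Rightarrow> 'a::comm_monoid_mult) \<Rightarrow> (nat \<Rightarrow> nat) \<Rightarrow> 'i list \<Rightarrow> 'a"
  where "braid_coeff Q w u = (\<Prod>(a, b)\<in>inversions (length u) w. Q (u ! (a - 1)) (u ! (b - 1)))"

lemma braid_gen_word:
  assumes "1 \<le> i" "i < length u"
  shows "braid_gen Q i (word u) = scalar (Q (u ! (i - 1)) (u ! i)) * word (permute_word (adj i) u)"
proof -
  obtain j where j: "i = Suc j" "Suc j < length u" using assms by (cases i) auto
  have 1: "take 2 (drop j u) = [u ! j, u ! Suc j]"
    using j by (simp add: numeral_2_eq_2 take_Suc_conv_app_nth flip: Cons_nth_drop_Suc)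
  have arith: "Suc (Suc (k - 2)) = k" if "\<not> k \<le> Suc j" for k
    using that by linarith
  have 2: "permute_word (adj i) u = take j u @ [u ! Suc j, u ! j] @ drop (Suc (Suc j)) u"
    by (rule nth_equalityI) (use j arith in \<open>auto simp: nth_permute_word nth_append nth_Cons' transpose_def\<close>)
  show ?thesis
    unfolding braid_gen_def lin_ext_word braiding_def 2 word_simps(2)
    by (simp add: j 1 lin_ext_word scalar_commute[of "Q _ _" "word (take j u)"] flip: mult.assoc)
qed

lemma module_hom_braid_composite:
  "module_hom scaleF scaleF (foldr (\<lambda>i f. braid_gen Q i \<circ> f) js id)"
proof (induction js)
  case Nil
  then show ?case by (simp add: module_hom_iff module_scaleF)
next
  case (Cons i js)
  have "module_hom scaleF scaleF (braid_gen Q i)"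
    unfolding braid_gen_def by (rule module_hom_lin_ext)
  then show ?case using module_hom_compose[OF Cons.IH] by (simp add: o_def)
qed

text \<open>
  Since \<open>js\<close> has as many factors as \<open>w\<close> has inversions, every factor must create an inversion. A
  factor \<open>i\<close> thus exchanges two letters that are still in their original order, and contributes the
  entry of \<open>Q\<close> belonging to exactly the new inversion.
\<close>

lemma braid_composite_word:
  assumes "is_expression (length u) w js" "length js = card (inversions (length u) w)"
  shows "foldr (\<lambda>i f. braid_gen Q i \<circ> f) js id (word u) =
    scalar (braid_coeff Q w u) * word (permute_word w u)"
  using assms
proof (induction js arbitrary: w)
  case Nil
  then have w: "w = id" by (simp add: is_expression_Nil)
  have "permute_word id u = u"
    by (rule nth_equalityI) (simp_all add: nth_permute_word)
  moreover have "braid_coeff Q id u = 1"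
    unfolding braid_coeff_def inversions_id by simp
  ultimately show ?case
    unfolding w foldr.simps id_apply by (simp only: scalar_simps(2) mult_1_left)
next
  case (Cons i js)
  let ?n = "length u"
  obtain f where i: "1 \<le> i" "i < ?n" and js: "is_expression ?n f js" and w: "w = adj i \<circ> f"
    using Cons.prems(1) by (auto simp: is_expression_Cons)
  have f: "f permutes {1..?n}" by (rule is_expression_permutes[OF js])
  have le: "card (inversions ?n f) \<le> length js" by (rule card_inversions_le_length[OF js])
  have card: "card (inversions ?n w) = Suc (length js)" using Cons.prems(2) by simp
  \<comment> \<open>Otherwise \<open>w\<close> would have fewer inversions than \<open>f\<close>, hence fewer than \<open>js\<close> has factors.\<close>
  have less: "inv f i < inv f (Suc i)"
    using card_inversions_adj_comp(1)[OF f i] le card by (auto simp: w split: if_splits)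
  then have "length js = card (inversions ?n f)"
    using card_inversions_adj_comp(1)[OF f i] card by (simp add: w)
  note IH = Cons.IH[OF js this]
  have coeff: "braid_coeff Q w u =
      Q (u ! (inv f i - 1)) (u ! (inv f (Suc i) - 1)) * braid_coeff Q f u"
    unfolding braid_coeff_def w
    using inversions_adj_comp[OF f i less] by simp
  have "braid_gen Q i (word (permute_word f u)) =
      scalar (Q (u ! (inv f i - 1)) (u ! (inv f (Suc i) - 1))) * word (permute_word w u)"
    using i by (simp add: braid_gen_word w permute_word_comp[OF f permutes_adj[OF i]] nth_permute_word)
  moreover have "braid_gen Q i (scaleF c x) = scaleF c (braid_gen Q i x)" for c x
    unfolding braid_gen_def by (rule module_hom.scale[OF module_hom_lin_ext])
  ultimately have "braid_gen Q i (scalar (braid_coeff Q f u) * word (permute_word f u)) =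
      scalar (braid_coeff Q f u * Q (u ! (inv f i - 1)) (u ! (inv f (Suc i) - 1))) *
        word (permute_word w u)"
    by (simp add: mult.assoc)
  then show ?case
    using IH coeff by (simp add: mult.commute del: scalar_simps(4))
qed

lemma braid_lift_word:
  assumes "w permutes {1..length u}"
  shows "braid_lift Q (length u) w (word u) = scalar (braid_coeff Q w u) * word (permute_word w u)"
  unfolding braid_lift_def by (rule braid_composite_word[OF reduced_expression_choice[OF assms]])

lemma quantum_symmetrizer_word:
  "quantum_symmetrizer Q (length u) (word u) =
    (\<Sum>w | w permutes {1..length u}. scalar (braid_coeff Q w u) * word (permute_word w u))"
  unfolding quantum_symmetrizer_def by (rule sum.cong) (auto simp: braid_lift_word)

lemma module_hom_quantum_symmetrizer: "module_hom scaleF scaleF (quantum_symmetrizer Q n)"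
proof -
  note hom = module_hom_braid_composite[of Q, unfolded module_hom_iff]
  show ?thesis
    by (simp add: module_hom_iff module_scaleF quantum_symmetrizer_def braid_lift_def hom
        sum.distrib sum_distrib_left)
qed

section \<open>The longest permutation\<close>

definition longest :: "nat \<Rightarrow> nat \<Rightarrow> nat"
  where "longest n k = (if 1 \<le> k \<and> k \<le> n then n + 1 - k else k)"

lemma permutes_longest: "longest n permutes {1..n}"
proof (rule bij_imp_permutes)
  show "bij_betw (longest n) {1..n} {1..n}"
    by (rule bij_betw_byWitness[of _ "longest n"]) (auto simp: longest_def)
qed (auto simp: longest_def)

lemma inversions_longest: "inversions n (longest n) = {(a, b). 1 \<le> a \<and> a < b \<and> b \<le> n}"
  by (auto simp: inversions_def longest_def)

text \<open>
  Composition with the longest permutation reverses the order of all values, so every pair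
  \<open>a < b\<close> is an inversion of exactly one of \<open>w\<close> and \<open>longest n \<circ> w\<close>.
\<close>

lemma braid_coeff_longest_comp:
  assumes "w permutes {1..length u}"
  shows "braid_coeff Q (longest (length u) \<circ> w) u * braid_coeff Q w u =
    braid_coeff Q (longest (length u)) u"
proof -
  let ?n = "length u"
  have img: "1 \<le> w a \<and> w a \<le> ?n" if "1 \<le> a" "a \<le> ?n" for a
    using permutes_in_image[OF assms, of a] that by auto
  have ne: "w a \<noteq> w b" if "a < b" for a b
    using permutes_inj[OF assms] that by (metis injD less_irrefl)
  have iff: "longest ?n (w b) < longest ?n (w a) \<longleftrightarrow> w a < w b"
    if "1 \<le> a" "a < b" "b \<le> ?n" for a b
    using img[of a] img[of b] that by (auto simp: longest_def)
  have "inversions ?n (longest ?n \<circ> w) \<inter> inversions ?n w = {}"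
    using iff by (fastforce simp: inversions_def)
  moreover have "inversions ?n (longest ?n \<circ> w) \<union> inversions ?n w = inversions ?n (longest ?n)"
    unfolding inversions_longest using iff ne by (fastforce simp: inversions_def neq_iff)
  ultimately show ?thesis
    unfolding braid_coeff_def by (metis prod.union_disjoint finite_inversions)
qed

text \<open>
  The coefficient of the longest permutation is the product over all unordered pairs of places,
  which \<open>w\<close> merely permutes. Unordered pairs are encoded as increasing ones, so the image of a pair
  has to be sorted, and symmetry of \<open>Q\<close> makes the sorting harmless.
\<close>

lemma braid_coeff_longest_permute_word:
  assumes symmetric: "\<And>i j. Q i j = Q j i" and w: "w permutes {1..length u}"
  shows "braid_coeff Q (longest (length u)) (permute_word w u) = braid_coeff Q (longest (length u)) u"
proof -
  let ?n = "length u"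
  let ?sort = "\<lambda>f (a, b). (min (f a) (f b), max (f a) (f b)) :: nat \<times> nat"
  have w': "inv w permutes {1..?n}" by (rule permutes_inv[OF w])
  have ww: "w (inv w x) = x" "inv w (w x) = x" for x
    using permutes_inverses[OF w] by auto
  have img: "1 \<le> w a \<and> w a \<le> ?n" "1 \<le> inv w a \<and> inv w a \<le> ?n" if "1 \<le> a" "a \<le> ?n" for a
    using permutes_in_image[OF w, of a] permutes_in_image[OF w', of a] that by auto
  have ne: "w a \<noteq> w b" "inv w a \<noteq> inv w b" if "a < b" for a b
    using that ww(1)[of a] ww(1)[of b] ww(2)[of a] ww(2)[of b] by auto
  have sort_mem: "?sort w p \<in> inversions ?n (longest ?n)" "?sort (inv w) p \<in> inversions ?n (longest ?n)"
    and sort_sort: "?sort w (?sort (inv w) p) = p" "?sort (inv w) (?sort w p) = p"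
    if "p \<in> inversions ?n (longest ?n)" for p
  proof -
    obtain a b where p: "p = (a, b)" "1 \<le> a" "a < b" "b \<le> ?n"
      using \<open>p \<in> inversions ?n (longest ?n)\<close> by (auto simp: inversions_longest)
    then show "?sort w p \<in> inversions ?n (longest ?n)" "?sort (inv w) p \<in> inversions ?n (longest ?n)"
      using img[of a] img[of b] ne[of a b] by (simp_all add: inversions_longest min_def max_def)
    show "?sort w (?sort (inv w) p) = p" "?sort (inv w) (?sort w p) = p"
      using p by (simp_all add: ww min_def max_def)
  qed
  have "(\<Prod>(a, b)\<in>inversions ?n (longest ?n). Q (permute_word w u ! (a - 1)) (permute_word w u ! (b - 1)))
      = (\<Prod>(a, b)\<in>inversions ?n (longest ?n). Q (u ! (a - 1)) (u ! (b - 1)))"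
  proof (rule prod.reindex_bij_witness[of _ "?sort w" "?sort (inv w)"])
    fix p assume p: "p \<in> inversions ?n (longest ?n)"
    then obtain a b where "p = (a, b)" "1 \<le> a" "a < b" "b \<le> ?n"
      by (auto simp: inversions_longest)
    then show "(case ?sort (inv w) p of (a, b) \<Rightarrow> Q (u ! (a - 1)) (u ! (b - 1))) =
        (case p of (a, b) \<Rightarrow> Q (permute_word w u ! (a - 1)) (permute_word w u ! (b - 1)))"
      using symmetric by (simp add: nth_permute_word min_def max_def)
  qed (rule sort_mem sort_sort, assumption)+
  then show ?thesis by (simp add: braid_coeff_def)
qed

section \<open>The bar involution and the quantum symmetrizer\<close>

lemma bar_coeffs_word: "bar_coeffs (word u) = word u"
  by (simp add: word_def bar_coeffs_single)

lemma bar_coeffs_bar_coeffs: "bar_coeffs (bar_coeffs x) = x"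
  by (rule poly_mapping_eqI) (simp add: lookup_bar_coeffs)

lemma additive_bar_coeffs: "additive bar_coeffs"
  by standard (rule bar_coeffs_add)

lemma bar_field_braid_coeff:
  assumes "\<And>i j. bar_field (Q i j) * Q i j = 1"
  shows "bar_field (braid_coeff Q w u) * braid_coeff Q w u = 1"
proof -
  have prod: "bar_field (\<Prod>x\<in>A. F x) * (\<Prod>x\<in>A. F x) = 1"
    if "\<And>x. bar_field (F x) * F x = 1" for F :: "nat \<times> nat \<Rightarrow> _" and A
  proof (induction A rule: infinite_finite_induct)
    case (insert x A)
    then show ?case using that[of x] by (simp add: bar_field_mult algebra_simps)
  qed simp_all
  show ?thesis unfolding braid_coeff_def case_prod_beta by (rule prod) (rule assms)
qed

text \<open>
  The operator of the longest permutation, given by the explicit formula for its values on words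
  and, like \<^const>\<open>braid_gen\<close>, for all degrees at once.
\<close>

definition longest_lift ::
    "('i \<Rightarrow> 'i \<Rightarrow> 'k::field poly fract) \<Rightarrow> ('i, 'k) tensor_algebra \<Rightarrow> ('i, 'k) tensor_algebra"
  where "longest_lift Q = lin_ext (\<lambda>v. scalar (braid_coeff Q (longest (length v)) v) *
    word (permute_word (longest (length v)) v))"

lemma module_hom_longest_lift: "module_hom scaleF scaleF (longest_lift Q)"
  unfolding longest_lift_def by (rule module_hom_lin_ext)

text \<open>
  The bar involution followed by the operator of the longest permutation sends the summand of \<open>w\<close>
  to that of \<open>longest n \<circ> w\<close>, and thus permutes the summands of the quantum symmetrizer.
\<close>

lemma quantum_symmetrizer_word_eq:
  fixes Q :: "'i \<Rightarrow> 'i \<Rightarrow> 'k::field poly fract"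
  assumes symmetric: "\<And>i j. Q i j = Q j i" and bar: "\<And>i j. bar_field (Q i j) * Q i j = 1"
  shows "quantum_symmetrizer Q (length u) (word u) =
    longest_lift Q (bar_coeffs (quantum_symmetrizer Q (length u) (word u)))"
proof -
  let ?n = "length u"
  let ?P = "{w. w permutes {1..?n}}"
  let ?term = "\<lambda>w. scalar (braid_coeff Q w u) * word (permute_word w u)"
  have "longest_lift Q (bar_coeffs (?term w)) = ?term (longest ?n \<circ> w)" if w: "w \<in> ?P" for w
  proof -
    have w: "w permutes {1..?n}" using w by simp
    have "longest_lift Q (bar_coeffs (?term w)) =
        scalar (bar_field (braid_coeff Q w u)) * longest_lift Q (word (permute_word w u))"
      by (simp add: bar_coeffs_mult bar_coeffs_scalar bar_coeffs_word
          module_hom.scale[OF module_hom_longest_lift])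
    also have "\<dots> = scalar (bar_field (braid_coeff Q w u) * braid_coeff Q (longest ?n) (permute_word w u)) *
        word (permute_word (longest ?n) (permute_word w u))"
      by (simp add: longest_lift_def lin_ext_word mult.assoc)
    also have "bar_field (braid_coeff Q w u) * braid_coeff Q (longest ?n) (permute_word w u) =
        (bar_field (braid_coeff Q w u) * braid_coeff Q w u) * braid_coeff Q (longest ?n \<circ> w) u"
      unfolding braid_coeff_longest_permute_word[OF symmetric w] braid_coeff_longest_comp[OF w, symmetric]
      by (simp only: mult_ac)
    also have "\<dots> = braid_coeff Q (longest ?n \<circ> w) u"
      by (simp add: bar_field_braid_coeff[OF bar])
    finally show ?thesis
      by (simp add: permute_word_comp[OF w permutes_longest])
  qed
  then have "longest_lift Q (bar_coeffs (\<Sum>w\<in>?P. ?term w)) = (\<Sum>w\<in>?P. ?term (longest ?n \<circ> w))"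
    by (simp add: additive.sum[OF additive_bar_coeffs] module_hom.sum[OF module_hom_longest_lift])
  also have "\<dots> = (\<Sum>w\<in>?P. ?term w)"
    using setum_permutations_compose_left[OF permutes_longest, of ?term] by simp
  finally show ?thesis by (simp add: quantum_symmetrizer_word)
qed

text \<open>
  Both sides are semilinear in \<open>x\<close> with respect to the bar involution of the coefficients, so the
  identity on words, which are fixed by the bar involution, suffices.
\<close>

lemma quantum_symmetrizer_bar_coeffs:
  fixes Q :: "'i \<Rightarrow> 'i \<Rightarrow> 'k::field poly fract"
  assumes symmetric: "\<And>i j. Q i j = Q j i" and bar: "\<And>i j. bar_field (Q i j) * Q i j = 1"
    and x: "x \<in> tensor_power n"
  shows "quantum_symmetrizer Q n (bar_coeffs x) = longest_lift Q (bar_coeffs (quantum_symmetrizer Q n x))"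
proof (rule additive_eq_on_words[where
      F = "\<lambda>x. quantum_symmetrizer Q n (bar_coeffs x)" and
      G = "\<lambda>x. longest_lift Q (bar_coeffs (quantum_symmetrizer Q n x))"])
  note S = module_hom_quantum_symmetrizer[of Q n] and L = module_hom_longest_lift[of Q]
  show "additive (\<lambda>x. quantum_symmetrizer Q n (bar_coeffs x))"
    by standard (simp add: bar_coeffs_add module_hom.add[OF S])
  show "additive (\<lambda>x. longest_lift Q (bar_coeffs (quantum_symmetrizer Q n x)))"
    by standard (simp add: bar_coeffs_add module_hom.add[OF S] module_hom.add[OF L])
  fix c u assume "u \<in> Poly_Mapping.keys x"
  then have n: "n = length u" using x by (simp add: tensor_power_def)
  have "quantum_symmetrizer Q n (bar_coeffs (scalar c * word u)) =
      scaleF (bar_field c) (quantum_symmetrizer Q n (word u))"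
    by (simp add: bar_coeffs_mult bar_coeffs_scalar bar_coeffs_word module_hom.scale[OF S])
  also have "quantum_symmetrizer Q n (word u) =
      longest_lift Q (bar_coeffs (quantum_symmetrizer Q n (word u)))"
    unfolding n by (rule quantum_symmetrizer_word_eq[OF symmetric bar])
  also have "scaleF (bar_field c) \<dots> =
      longest_lift Q (bar_coeffs (quantum_symmetrizer Q n (scalar c * word u)))"
    by (simp add: bar_coeffs_mult bar_coeffs_scalar module_hom.scale[OF S] module_hom.scale[OF L])
  finally show "quantum_symmetrizer Q n (bar_coeffs (scalar c * word u)) =
      longest_lift Q (bar_coeffs (quantum_symmetrizer Q n (scalar c * word u)))" .
qed

lemma bar_coeffs_ker_symmetrizer:
  assumes "\<And>i j. Q i j = Q j i" and "\<And>i j. bar_field (Q i j) * Q i j = 1"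
    and x: "x \<in> ker_symmetrizer Q n"
  shows "bar_coeffs x \<in> ker_symmetrizer Q n"
proof -
  have "bar_coeffs x \<in> tensor_power n"
    using x by (auto simp: ker_symmetrizer_def tensor_power_def in_keys_iff lookup_bar_coeffs)
  then show ?thesis
    using x quantum_symmetrizer_bar_coeffs[OF assms(1,2), of x n]
    by (simp add: ker_symmetrizer_def module_hom.zero[OF module_hom_longest_lift])
qed

section \<open>The defining ideal\<close>

lemma subspace_ker_symmetrizer:
  fixes Q :: "'i \<Rightarrow> 'i \<Rightarrow> 'k::field poly fract"
  shows "module.subspace scaleF (ker_symmetrizer Q n)"
proof -
  note S = module_hom_quantum_symmetrizer[of Q n]
  have "x + y \<in> tensor_power n" if "x \<in> tensor_power n" "y \<in> tensor_power n"
    for x y :: "('i, 'k) tensor_algebra"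
    using that Poly_Mapping.keys_add[of x y] by (auto simp: tensor_power_def)
  moreover have "scaleF c x \<in> tensor_power n" if "x \<in> tensor_power n"
    for c and x :: "('i, 'k) tensor_algebra"
    using that by (auto simp: tensor_power_def in_keys_iff lookup_scaleF)
  ultimately show ?thesis
    by (simp add: module.subspace_def[OF module_scaleF] ker_symmetrizer_def
        module_hom.add[OF S] module_hom.scale[OF S] module_hom.zero[OF S])
      (simp add: tensor_power_def)
qed

lemma nichols_ideal_image:
  assumes "additive h" and "\<And>n x. x \<in> ker_symmetrizer Q n \<Longrightarrow> h x \<in> ker_symmetrizer Q n"
    and "x \<in> nichols_ideal Q"
  shows "h x \<in> nichols_ideal Q"
proof -
  obtain A f where A: "finite A" "A \<subseteq> {2..}" "\<forall>n\<in>A. f n \<in> ker_symmetrizer Q n"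
    and x: "x = (\<Sum>n\<in>A. f n)"
    using assms(3) by (auto simp: nichols_ideal_def)
  have "h x = (\<Sum>n\<in>A. h (f n))" unfolding x by (rule additive.sum[OF assms(1)])
  moreover have "\<forall>n\<in>A. h (f n) \<in> ker_symmetrizer Q n" using A assms(2) by blast
  ultimately show ?thesis
    unfolding nichols_ideal_def using A by blast
qed

lemma nichols_ideal_add:
  assumes "x \<in> nichols_ideal Q" "y \<in> nichols_ideal Q"
  shows "x + y \<in> nichols_ideal Q"
proof -
  obtain A f where A: "finite A" "A \<subseteq> {2..}" "\<forall>n\<in>A. f n \<in> ker_symmetrizer Q n"
    and x: "x = (\<Sum>n\<in>A. f n)"
    using assms(1) by (auto simp: nichols_ideal_def)
  obtain B g where B: "finite B" "B \<subseteq> {2..}" "\<forall>n\<in>B. g n \<in> ker_symmetrizer Q n"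
    and y: "y = (\<Sum>n\<in>B. g n)"
    using assms(2) by (auto simp: nichols_ideal_def)
  note subspace = subspace_ker_symmetrizer[of Q, unfolded module.subspace_def[OF module_scaleF]]
  \<comment> \<open>Both decompositions are extended by zero to the common set of degrees.\<close>
  define h where "h n = (if n \<in> A then f n else 0) + (if n \<in> B then g n else 0)" for n
  have "(\<Sum>n\<in>A \<union> B. h n) = x + y"
    using A(1) B(1) unfolding h_def x y
    by (simp add: sum.distrib sum.If_cases Int_absorb1 Int_absorb2 flip: sum.inter_restrict)
  moreover have "\<forall>n\<in>A \<union> B. h n \<in> ker_symmetrizer Q n"
    using A(3) B(3) subspace unfolding h_def by simp
  ultimately show ?thesis
    unfolding nichols_ideal_def using A B
    by (intro CollectI exI[of _ "A \<union> B"] exI[of _ h]) auto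
qed

lemma subspace_nichols_ideal:
  fixes Q :: "'i \<Rightarrow> 'i \<Rightarrow> 'k::field poly fract"
  shows "module.subspace scaleK (nichols_ideal Q)"
proof -
  have "0 \<in> nichols_ideal Q"
    unfolding nichols_ideal_def by (intro CollectI exI[of _ "{}"]) simp
  moreover have "scaleK c x \<in> nichols_ideal Q" if "x \<in> nichols_ideal Q" for c x
  proof (rule nichols_ideal_image[OF _ _ that])
    show "additive (scaleK c)" by standard (simp add: scaleK_def distrib_left)
    show "scaleK c y \<in> ker_symmetrizer Q n" if "y \<in> ker_symmetrizer Q n" for n y
      using that subspace_ker_symmetrizer[of Q n]
      by (simp add: scaleK_def module.subspace_def[OF module_scaleF])
  qed
  moreover have "module (scaleK :: 'k \<Rightarrow> ('i, 'k) tensor_algebra \<Rightarrow> _)"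
    using vector_space_scaleK by (simp add: module_iff_vector_space)
  ultimately show ?thesis
    by (simp add: module.subspace_def nichols_ideal_add)
qed

lemma bar_field_powi_qhalf:
  "bar_field (qhalf powi m) = inverse (qhalf powi m :: 'k::field poly fract)"
proof -
  have "bar_field (a ^ k) = bar_field a ^ k" for a :: "'k poly fract" and k
    by (induction k) (simp_all add: bar_field_mult)
  then show ?thesis
    by (simp add: power_int_def bar_field_inverse power_inverse)
qed

theorem proposition8:
  fixes Q :: "'i::finite \<Rightarrow> 'i \<Rightarrow> 'k::field_char_0 poly fract"
  assumes symmetric: "\<And>i j. Q i j = Q j i"
    and powers: "\<And>i j. \<exists>m::int. Q i j = qhalf powi m"
  shows "linear_automorphism_on scaleK (nichols_ideal Q) bar_involution"
proof -
  have bar: "bar_field (Q i j) * Q i j = 1" for i j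
    using powers[of i j] by (auto simp: bar_field_powi_qhalf power_int_eq_0_iff)
  have maps: "bar_coeffs x \<in> nichols_ideal Q" if "x \<in> nichols_ideal Q" for x
    using additive_bar_coeffs bar_coeffs_ker_symmetrizer[OF symmetric bar] that
    by (rule nichols_ideal_image)
  then have "bij_betw bar_coeffs (nichols_ideal Q) (nichols_ideal Q)"
    by (intro bij_betw_byWitness[of _ bar_coeffs]) (auto simp: bar_coeffs_bar_coeffs)
  then show ?thesis
    by (simp add: linear_automorphism_on_def bar_involution_eq_bar_coeffs subspace_nichols_ideal
        bar_coeffs_add scaleK_def bar_coeffs_mult bar_coeffs_scalar)
qed

end
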